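(* Let $(X,\|\cdot\|)$ be a real Banach space with $\dim X>1$. Then Birkhoff-James orthogonality is right additive in $X$ if and only if $(X,\|\cdot\|)$ is smooth.
   Context: Birkhoff-James orthogonality: $x\perp_B y$ iff $\|x\|\le\|x+\lambda y\|$ for all $\lambda\in\mathbb{R}$. It is right additive in $X$ if for all $x,y,z\in X$, $x\perp_B y$ and $x\perp_B z$ imply $x\perp_B(y+z)$. $X$ is smooth if there is a unique supporting hyperplane to the unit ball of $X$ at every point of the unit sphere, i.e. for each $u\in X$ with $\|u\|=1$ there is exactly one $f\in X^*$ with $\|f\|=1$ and $f(u)=1$. *)

theory Defs
  imports "HOL-Analysis.Analysis"
begin

definition bj_orthogonal :: "'a::real_normed_vector \<Rightarrow> 'a \<Rightarrow> bool"  (infix "\<bottom>\<^sub>B" 50)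
  where "x \<bottom>\<^sub>B y \<longleftrightarrow> (\<forall>c::real. norm x \<le> norm (x + c *\<^sub>R y))"

definition bj_right_additive :: "'a::real_normed_vector itself \<Rightarrow> bool"
  where "bj_right_additive _ \<longleftrightarrow>
    (\<forall>x y z :: 'a. x \<bottom>\<^sub>B y \<longrightarrow> x \<bottom>\<^sub>B z \<longrightarrow> x \<bottom>\<^sub>B (y + z))"

(* A supporting hyperplane of the unit ball at u is identified with the norming
   functional f, an element of the dual space, that is normalised by norm f = 1
   and takes the value 1 at u. *)
definition smooth_space :: "'a::real_normed_vector itself \<Rightarrow> bool"
  where "smooth_space _ \<longleftrightarrow>
    (\<forall>u :: 'a. norm u = 1 \<longrightarrow>
      (\<exists>!f :: 'a \<Rightarrow>\<^sub>L real. norm f = 1 \<and> blinfun_apply f u = 1))"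

(* The library's dim is 0 for spaces without a finite basis, so the condition
   that the dimension exceeds 1 is phrased through a Hamel basis, which is
   allowed to be infinite. *)
definition dim_greater_one :: "'a::real_vector itself \<Rightarrow> bool"
  where "dim_greater_one _ \<longleftrightarrow>
    (\<exists>B :: 'a set. independent B \<and> span B = UNIV \<and> (infinite B \<or> card B > 1))"

end

theory Submission
  imports Defs
begin

text \<open>
  The link between orthogonality and duality is the Hahn--Banach theorem: for a unit vector
  \<open>u\<close>, we have \<open>u \<bottom>\<^sub>B y\<close> iff some norming functional at \<open>u\<close> vanishes at \<open>y\<close>. If the norming
  functional \<open>f\<close> is unique, the vectors orthogonal to \<open>u\<close> thus form its kernel. If instead
  \<open>f\<close> and \<open>g\<close> both norm \<open>u\<close> and \<open>f y \<noteq> g y\<close>, then \<open>u\<close> is orthogonal to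
  \<open>y - f y u\<close> and to \<open>g y u - y\<close>, but not to their sum, a nonzero multiple of \<open>u\<close>.
\<close>

section \<open>Sublinear functionals and their pointwise infima\<close>

text \<open>Scaling is demanded only as an inequality, which is what infimum constructions deliver
  directly; scaling back by \<open>inverse c\<close> turns it into the equality of
  \<open>sublinear_scale\<close>.\<close>

definition sublinear :: "('a::real_vector \<Rightarrow> real) \<Rightarrow> bool"
  where "sublinear p \<longleftrightarrow>
    (\<forall>x y. p (x + y) \<le> p x + p y) \<and> (\<forall>c x. 0 \<le> c \<longrightarrow> p (c *\<^sub>R x) \<le> c * p x)"

lemma sublinearI:
  assumes "\<And>x y. p (x + y) \<le> p x + p y" "\<And>c x. 0 \<le> c \<Longrightarrow> p (c *\<^sub>R x) \<le> c * p x"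
  shows "sublinear p"
  using assms by (simp add: sublinear_def)

lemma sublinear_add: "sublinear p \<Longrightarrow> p (x + y) \<le> p x + p y"
  by (simp add: sublinear_def)

lemma sublinear_zero:
  assumes "sublinear p"
  shows "p 0 = 0"
proof -
  have "p (0 *\<^sub>R 0) \<le> 0 * p 0"
    using assms unfolding sublinear_def by blast
  then show ?thesis
    using sublinear_add[OF assms, of 0 0] by simp
qed

lemma sublinear_scale:
  assumes p: "sublinear p" and "0 \<le> c"
  shows "p (c *\<^sub>R x) = c * p x"
proof (cases "c = 0")
  case True
  then show ?thesis by (simp add: sublinear_zero[OF p])
next
  case False
  then have "c > 0" using \<open>0 \<le> c\<close> by simp
  have le: "p (d *\<^sub>R z) \<le> d * p z" if "0 \<le> d" for d z
    using p that unfolding sublinear_def by blast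
  have "p x \<le> inverse c * p (c *\<^sub>R x)"
    using le[of "inverse c" "c *\<^sub>R x"] \<open>c > 0\<close> by simp
  then have "c * p x \<le> p (c *\<^sub>R x)"
    using \<open>c > 0\<close> by (simp add: field_simps)
  then show ?thesis
    using le[OF \<open>0 \<le> c\<close>, of x] by simp
qed

lemma sublinear_ge_neg:
  assumes "sublinear p"
  shows "- p (- x) \<le> p x"
  using sublinear_add[OF assms, of x "- x"] by (simp add: sublinear_zero[OF assms])

text \<open>This serves three infima: along a ray of translates, over a chain of functionals, and
  over a line in the quotient seminorm. The index \<open>k\<close> is chosen after \<open>i\<close>,
  \<open>j\<close>, \<open>x\<close>, \<open>y\<close>, so it can be a sum of parameters or the
  smaller of two chain members.\<close>

lemma sublinear_INF:
  assumes ne: "I \<noteq> {}"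
    and bdd: "\<And>x. bdd_below ((\<lambda>i. F i x) ` I)"
    and add: "\<And>i j x y. i \<in> I \<Longrightarrow> j \<in> I \<Longrightarrow> \<exists>k\<in>I. F k (x + y) \<le> F i x + F j y"
    and scale: "\<And>c i x. 0 \<le> c \<Longrightarrow> i \<in> I \<Longrightarrow> \<exists>k\<in>I. F k (c *\<^sub>R x) \<le> c * F i x"
  shows "sublinear (\<lambda>x. INF i\<in>I. F i x)"
proof (rule sublinearI)
  let ?q = "\<lambda>x. INF i\<in>I. F i x"
  have lower: "?q x \<le> F i x" if "i \<in> I" for i x
    using cINF_lower[OF bdd that] .
  show "?q (x + y) \<le> ?q x + ?q y" for x y
  proof -
    have 1: "?q (x + y) \<le> F i x + F j y" if "i \<in> I" "j \<in> I" for i j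
      using add[OF that, of x y] lower[of _ "x + y"] order_trans by blast
    \<comment> \<open>With \<open>j\<close> fixed, the infimum is taken over \<open>i\<close>; the
      next step takes it over \<open>j\<close>.\<close>
    have "?q (x + y) - F j y \<le> ?q x" if "j \<in> I" for j
      by (rule cINF_greatest[OF ne]) (use 1 that in fastforce)
    then have "?q (x + y) - ?q x \<le> ?q y"
      by (intro cINF_greatest[OF ne]) fastforce
    then show ?thesis by simp
  qed
  show "?q (c *\<^sub>R x) \<le> c * ?q x" if c: "0 \<le> c" for c x
  proof -
    have 1: "?q (c *\<^sub>R x) \<le> c * F i x" if "i \<in> I" for i
      using scale[OF c that, of x] lower[of _ "c *\<^sub>R x"] order_trans by blast
    show ?thesis
    proof (cases "c = 0")
      case True
      then show ?thesis using 1 ne by force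
    next
      case False
      then have "?q (c *\<^sub>R x) / c \<le> ?q x"
        using 1 c by (intro cINF_greatest[OF ne]) (simp add: field_simps)
      then show ?thesis using False c by (simp add: field_simps)
    qed
  qed
qed

text \<open>Infimising \<open>p (x + t y) - t p y\<close> over t \<ge> 0 lowers \<open>p\<close>
  just enough to make it odd at \<open>y\<close>. This shows that minimal sublinear functionals are
  odd, and later prescribes a value in the Hahn-Banach theorem.\<close>

lemma sublinear_descent:
  assumes p: "sublinear p"
  obtains q where "sublinear q" "\<And>x. q x \<le> p x" "q (- y) = - p y"
proof
  define F where "F t x = p (x + t *\<^sub>R y) - t * p y" for t x
  define q where "q x = (INF t\<in>{0..}. F t x)" for x
  \<comment> \<open>Writing \<open>t y\<close> as \<open>(x + t y) + (- x)\<close> bounds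
    \<open>t p y\<close> by \<open>p (x + t y) + p (- x)\<close>, so the infimum is finite.\<close>
  have ge: "- p (- x) \<le> F t x" if "t \<in> {0..}" for t x
    using sublinear_add[OF p, of "x + t *\<^sub>R y" "- x"] sublinear_scale[OF p, of t y] that
    by (simp add: F_def)
  have bdd: "bdd_below ((\<lambda>t. F t x) ` {0..})" for x
    using ge by (intro bdd_belowI2)
  have lower: "q x \<le> F t x" if "t \<in> {0..}" for t x
    unfolding q_def using cINF_lower[OF bdd that] .
  show "sublinear q"
    unfolding q_def
  proof (rule sublinear_INF)
    show "{0::real..} \<noteq> {}" by auto
  next
    show "bdd_below ((\<lambda>t. F t x) ` {0..})" for x by (rule bdd)
  next
    fix s t :: real and x z :: 'a
    assume "s \<in> {0..}" "t \<in> {0..}"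
    moreover have "F (s + t) (x + z) \<le> F s x + F t z"
      using sublinear_add[OF p, of "x + s *\<^sub>R y" "z + t *\<^sub>R y"]
      by (simp add: F_def algebra_simps)
    ultimately show "\<exists>r\<in>{0..}. F r (x + z) \<le> F s x + F t z"
      by (intro bexI[of _ "s + t"]) auto
  next
    fix c t :: real and x :: 'a
    assume "0 \<le> c" "t \<in> {0..}"
    moreover have "F (c * t) (c *\<^sub>R x) = c * F t x"
      using sublinear_scale[OF p \<open>0 \<le> c\<close>, of "x + t *\<^sub>R y"]
      by (simp add: F_def algebra_simps)
    ultimately show "\<exists>r\<in>{0..}. F r (c *\<^sub>R x) \<le> c * F t x"
      by (intro bexI[of _ "c * t"]) auto
  qed
  show "q x \<le> p x" for x
    using lower[of 0 x] by (simp add: F_def)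
  \<comment> \<open>The general lower bound at \<open>- y\<close> is \<open>- p y\<close>, and
    \<open>t = 1\<close> attains it.\<close>
  have "- p y \<le> q (- y)"
    unfolding q_def using ge[of _ "- y"] by (intro cINF_greatest) auto
  then show "q (- y) = - p y"
    using lower[of 1 "- y"] by (simp add: F_def sublinear_zero[OF p])
qed

section \<open>The Hahn-Banach theorem by minimality\<close>

text \<open>By minimality the descent at any \<open>y\<close> changes nothing, so \<open>q\<close>
  is odd. Subadditivity at the negated vectors then gives the reverse inequality, hence
  additivity.\<close>

lemma minimal_sublinear_linear:
  assumes q: "sublinear q"
    and min: "\<And>r. sublinear r \<Longrightarrow> (\<And>x. r x \<le> q x) \<Longrightarrow> r = q"
  shows "linear q"
proof -
  have neg: "q (- y) = - q y" for y
    using sublinear_descent[OF q, of y] min by metis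
  show ?thesis
  proof (rule linearI)
    fix x y
    have "q (- x + - y) \<le> q (- x) + q (- y)" by (rule sublinear_add[OF q])
    moreover have "q (- x + - y) = - q (x + y)" using neg[of "x + y"] by simp
    ultimately show "q (x + y) = q x + q y"
      using sublinear_add[OF q, of x y] by (simp add: neg)
  next
    fix c x
    show "q (c *\<^sub>R x) = c *\<^sub>R q x"
    proof (cases "0 \<le> c")
      case True
      then show ?thesis using sublinear_scale[OF q] by simp
    next
      case False
      then show ?thesis
        using sublinear_scale[OF q, of "- c" x] neg[of "c *\<^sub>R x"] by simp
    qed
  qed
qed

lemma ex_linear_le_sublinear:
  assumes p: "sublinear p"
  obtains f where "linear f" "\<And>x. f x \<le> p x"
proof -
  define A where "A = {q. sublinear q \<and> q \<le> p}"
  \<comment> \<open>Zorn's lemma is used for the reversed order, so a maximal element is a minimal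
    sublinear functional below \<open>p\<close>.\<close>
  have "\<exists>m\<in>A. \<forall>a\<in>A. m \<ge> a \<longrightarrow> a = m"
  proof (rule predicate_Zorn)
    show "partial_order_on A (relation_of (\<ge>) A)"
      by (rule partial_order_on_relation_ofI) auto
  next
    fix C assume "C \<in> Chains (relation_of (\<ge>) A)"
    then have C: "C \<subseteq> A" and chain: "\<And>r s. r \<in> C \<Longrightarrow> s \<in> C \<Longrightarrow> r \<le> s \<or> s \<le> r"
      by (auto simp: Chains_def relation_of_def)
    show "\<exists>u\<in>A. \<forall>a\<in>C. a \<ge> u"
    proof (cases "C = {}")
      case True
      then show ?thesis using p by (auto simp: A_def)
    next
      case False
      \<comment> \<open>Every member satisfies \<open>r x\<close> \<ge> \<open>- r (- x)\<close>
        \<ge> \<open>- p (- x)\<close>, a bound independent of \<open>r\<close>.\<close>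
      have bdd: "bdd_below ((\<lambda>r. r x) ` C)" for x
      proof (rule bdd_belowI2)
        fix r assume "r \<in> C"
        then have r: "sublinear r" "r (- x) \<le> p (- x)"
          using C by (auto simp: A_def le_fun_def)
        then show "- p (- x) \<le> r x"
          using sublinear_ge_neg[OF r(1), of x] by simp
      qed
      let ?q = "\<lambda>x. INF r\<in>C. r x"
      have lower: "?q \<le> r" if "r \<in> C" for r
        using cINF_lower[OF bdd that] by (simp add: le_fun_def)
      have "sublinear ?q"
      proof (rule sublinear_INF[OF False bdd])
        fix r s x y assume rs: "r \<in> C" "s \<in> C"
        \<comment> \<open>Since \<open>C\<close> is a chain, the smaller of \<open>r\<close> and
          \<open>s\<close> dominates neither and is subadditive on its own.\<close>
        then obtain m where m: "m \<in> C" "m \<le> r" "m \<le> s"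
          using chain by blast
        then have "sublinear m" using C by (auto simp: A_def)
        then have "m (x + y) \<le> m x + m y" by (rule sublinear_add)
        also have "\<dots> \<le> r x + s y"
          using m by (intro add_mono) (auto simp: le_fun_def)
        finally show "\<exists>k\<in>C. k (x + y) \<le> r x + s y" using m by blast
      next
        fix c :: real and r x assume "0 \<le> c" "r \<in> C"
        then have "sublinear r" using C by (auto simp: A_def)
        then have "r (c *\<^sub>R x) \<le> c * r x"
          using sublinear_scale[OF _ \<open>0 \<le> c\<close>, of r x] by simp
        then show "\<exists>k\<in>C. k (c *\<^sub>R x) \<le> c * r x"
          using \<open>r \<in> C\<close> by (rule bexI)
      qed
      moreover have "?q \<le> p"
      proof -
        obtain r where "r \<in> C" using False by blast
        then have "r \<le> p" using C by (auto simp: A_def)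
        with lower[OF \<open>r \<in> C\<close>] show ?thesis by (rule order_trans)
      qed
      ultimately have "?q \<in> A" by (simp add: A_def)
      then show ?thesis using lower by blast
    qed
  qed
  then obtain m where m: "m \<in> A" "\<And>a. a \<in> A \<Longrightarrow> a \<le> m \<Longrightarrow> a = m" by blast
  have "linear m"
  proof (rule minimal_sublinear_linear)
    show "sublinear m" using m by (simp add: A_def)
    fix r assume "sublinear r" "\<And>x. r x \<le> m x"
    then show "r = m"
      using m by (intro m(2)) (auto simp: A_def le_fun_def intro: order_trans)
  qed
  moreover have "m x \<le> p x" for x
    using m by (simp add: A_def le_fun_def)
  ultimately show ?thesis using that by blast
qed

text \<open>Descending at \<open>u\<close> first yields \<open>q (- u) = - p u\<close>, so every
  linear functional below \<open>q\<close> takes at least the value \<open>p u\<close> at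
  \<open>u\<close>.\<close>

theorem Hahn_Banach_sublinear:
  assumes p: "sublinear p"
  obtains f where "linear f" "\<And>x. f x \<le> p x" "f u = p u"
proof -
  obtain q where q: "sublinear q" "\<And>x. q x \<le> p x" "q (- u) = - p u"
    using sublinear_descent[OF p] by blast
  obtain f where f: "linear f" "\<And>x. f x \<le> q x"
    using ex_linear_le_sublinear[OF q(1)] by blast
  have "f x \<le> p x" for x
    using f(2)[of x] q(2)[of x] by simp
  moreover from this have "f u = p u"
    using f(2)[of "- u"] q(3) linear_neg[OF f(1), of u] by (intro antisym) auto
  ultimately show ?thesis using that f(1) by blast
qed

section \<open>Norming functionals and orthogonality\<close>

lemma blinfun_of_linear_le_norm:
  fixes f :: "'a::real_normed_vector \<Rightarrow> real"
  assumes f: "linear f" and le: "\<And>x. f x \<le> norm x" and u: "norm u = 1" "f u = 1"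
  obtains F :: "'a \<Rightarrow>\<^sub>L real" where "blinfun_apply F = f" "norm F = 1"
proof -
  have abs: "\<bar>f x\<bar> \<le> norm x" for x
    using le[of x] le[of "- x"] linear_neg[OF f, of x] by simp
  have "bounded_linear f"
    using abs by (intro bounded_linear_intro[where K = 1])
      (auto simp: linear_add[OF f] linear_cmul[OF f])
  then have app: "blinfun_apply (Blinfun f) = f"
    by (rule bounded_linear_Blinfun_apply)
  have "norm (Blinfun f) \<le> 1"
    using abs by (intro norm_blinfun_bound) (auto simp: app)
  moreover have "1 \<le> norm (Blinfun f)"
    using norm_blinfun[of "Blinfun f" u] u by (simp add: app)
  ultimately show ?thesis using that app by simp
qed

text \<open>A functional vanishing at \<open>y\<close> is constant on the line through
  \<open>u\<close> in direction \<open>y\<close>, and having norm 1 it bounds the norm there from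
  below.\<close>

lemma bj_orthogonal_if_norming:
  fixes f :: "'a::real_normed_vector \<Rightarrow>\<^sub>L real"
  assumes "norm f = 1" "blinfun_apply f u = norm u" "blinfun_apply f y = 0"
  shows "u \<bottom>\<^sub>B y"
  unfolding bj_orthogonal_def
proof
  fix c
  have "norm u = f (u + c *\<^sub>R y)"
    using assms by (simp add: blinfun.add_right blinfun.scaleR_right)
  also have "\<dots> \<le> norm (u + c *\<^sub>R y)"
    using norm_blinfun[of f "u + c *\<^sub>R y"] assms(1) by simp
  finally show "norm u \<le> norm (u + c *\<^sub>R y)" .
qed

text \<open>Hahn--Banach is applied to the quotient seminorm modulo the line through \<open>y\<close>, which
  coincides with the norm at \<open>u\<close> precisely because \<open>u \<bottom>\<^sub>B y\<close>.\<close>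

lemma bj_orthogonal_norming:
  fixes u y :: "'a::real_normed_vector"
  assumes orth: "u \<bottom>\<^sub>B y" and u: "norm u = 1"
  obtains f :: "'a \<Rightarrow>\<^sub>L real"
  where "norm f = 1" "blinfun_apply f u = 1" "blinfun_apply f y = 0"
proof -
  define p where "p x = (INF c. norm (x + c *\<^sub>R y))" for x
  have bdd: "bdd_below (range (\<lambda>c. norm (x + c *\<^sub>R y)))" for x
    by (intro bdd_belowI2[of _ 0]) simp
  have lower: "p x \<le> norm (x + c *\<^sub>R y)" for x c
    unfolding p_def by (rule cINF_lower[OF bdd]) simp
  have p: "sublinear p"
    unfolding p_def
  proof (rule sublinear_INF[OF _ bdd])
    fix c d :: real and x z :: 'a
    have "norm (x + z + (c + d) *\<^sub>R y) \<le> norm (x + c *\<^sub>R y) + norm (z + d *\<^sub>R y)"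
      using norm_triangle_ineq[of "x + c *\<^sub>R y" "z + d *\<^sub>R y"] by (simp add: algebra_simps)
    then show "\<exists>k\<in>UNIV. norm (x + z + k *\<^sub>R y) \<le> norm (x + c *\<^sub>R y) + norm (z + d *\<^sub>R y)"
      by blast
  next
    fix c d :: real and x :: 'a
    assume "0 \<le> c"
    then have "norm (c *\<^sub>R x + (c * d) *\<^sub>R y) = c * norm (x + d *\<^sub>R y)"
      using norm_scaleR[of c "x + d *\<^sub>R y"] by (simp add: scaleR_right_distrib)
    then show "\<exists>k\<in>UNIV. norm (c *\<^sub>R x + k *\<^sub>R y) \<le> c * norm (x + d *\<^sub>R y)"
      by (metis UNIV_I order_refl)
  qed simp
  have "1 \<le> p u"
    unfolding p_def using orth u by (intro cINF_greatest) (auto simp: bj_orthogonal_def)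
  then have pu: "p u = 1"
    using lower[of u 0] u by simp
  obtain f where f: "linear f" "\<And>x. f x \<le> p x" "f u = p u"
    using Hahn_Banach_sublinear[OF p] by blast
  have "f x \<le> norm x" for x
    using f(2)[of x] lower[of x 0] by simp
  then obtain F :: "'a \<Rightarrow>\<^sub>L real" where F: "blinfun_apply F = f" "norm F = 1"
    using blinfun_of_linear_le_norm[OF f(1) _ u] f(3) pu by metis
  \<comment> \<open>The seminorm \<open>p\<close> is at most 0 at \<open>y\<close> and at
    \<open>- y\<close>: the shifts by \<open>-1\<close> and \<open>1\<close> reach the zero
    vector.\<close>
  have "f y \<le> 0" "f (- y) \<le> 0"
    using f(2)[of y] lower[of y "-1"] f(2)[of "- y"] lower[of "- y" 1] by simp_all
  then have "f y = 0"
    by (simp add: linear_neg[OF f(1)])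
  then show ?thesis using that F f(3) pu by simp
qed

lemma bj_orthogonal_zero_right: "x \<bottom>\<^sub>B 0"
  by (simp add: bj_orthogonal_def)

lemma bj_orthogonal_uminus_right:
  assumes "x \<bottom>\<^sub>B y"
  shows "x \<bottom>\<^sub>B - y"
  unfolding bj_orthogonal_def
proof
  fix c
  show "norm x \<le> norm (x + c *\<^sub>R - y)"
    using assms[unfolded bj_orthogonal_def, rule_format, of "- c"] by simp
qed

lemma not_bj_orthogonal_scaleR_self:
  assumes "x \<noteq> 0" "a \<noteq> 0"
  shows "\<not> x \<bottom>\<^sub>B a *\<^sub>R x"
proof
  assume "x \<bottom>\<^sub>B a *\<^sub>R x"
  then have "norm x \<le> norm (x + (- inverse a) *\<^sub>R (a *\<^sub>R x))"
    unfolding bj_orthogonal_def by blast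
  then show False using assms by simp
qed

lemma bj_orthogonal_scaleR_left:
  assumes "x \<bottom>\<^sub>B y"
  shows "a *\<^sub>R x \<bottom>\<^sub>B y"
proof (cases "a = 0")
  case True
  then show ?thesis by (simp add: bj_orthogonal_def)
next
  case False
  show ?thesis
    unfolding bj_orthogonal_def
  proof
    fix c
    have "norm x \<le> norm (x + (c / a) *\<^sub>R y)"
      using assms unfolding bj_orthogonal_def by blast
    then have "norm (a *\<^sub>R x) \<le> norm (a *\<^sub>R (x + (c / a) *\<^sub>R y))"
      by (simp add: mult_left_mono)
    also have "a *\<^sub>R (x + (c / a) *\<^sub>R y) = a *\<^sub>R x + c *\<^sub>R y"
      using False by (simp add: scaleR_right_distrib)
    finally show "norm (a *\<^sub>R x) \<le> norm (a *\<^sub>R x + c *\<^sub>R y)" .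
  qed
qed

section \<open>Right additivity and smoothness\<close>

lemma norming_functional_unique:
  fixes f g :: "'a::real_normed_vector \<Rightarrow>\<^sub>L real"
  assumes add: "bj_right_additive TYPE('a)" and u: "norm u = 1"
    and f: "norm f = 1" "blinfun_apply f u = 1"
    and g: "norm g = 1" "blinfun_apply g u = 1"
  shows "f = g"
proof (rule blinfun_eqI, rule ccontr)
  fix y assume "blinfun_apply f y \<noteq> blinfun_apply g y"
  then have ne: "g y - f y \<noteq> 0" by simp
  have u0: "u \<noteq> 0" using u by auto
  have orth: "u \<bottom>\<^sub>B y - h y *\<^sub>R u" if "norm h = 1" "blinfun_apply h u = 1" for h :: "'a \<Rightarrow>\<^sub>L real"
    using that u
    by (intro bj_orthogonal_if_norming[of h]) (simp_all add: blinfun.diff_right blinfun.scaleR_right)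
  have "u \<bottom>\<^sub>B (y - f y *\<^sub>R u) + - (y - g y *\<^sub>R u)"
    using add orth[OF f] bj_orthogonal_uminus_right[OF orth[OF g]]
    unfolding bj_right_additive_def by blast
  also have "(y - f y *\<^sub>R u) + - (y - g y *\<^sub>R u) = (g y - f y) *\<^sub>R u"
    by (simp add: algebra_simps)
  finally show False
    using not_bj_orthogonal_scaleR_self[OF u0 ne] by contradiction
qed

text \<open>After normalising \<open>x\<close>, each orthogonality supplies a norming functional at
  \<open>u\<close>. Smoothness identifies the two, so a single one vanishes at both \<open>y\<close>
  and \<open>z\<close>, hence at \<open>y + z\<close>.\<close>

lemma smooth_imp_right_additive:
  assumes smooth: "smooth_space TYPE('a::real_normed_vector)"
  shows "bj_right_additive TYPE('a)"
  unfolding bj_right_additive_def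
proof (intro allI impI)
  fix x y z :: 'a
  assume orth: "x \<bottom>\<^sub>B y" "x \<bottom>\<^sub>B z"
  show "x \<bottom>\<^sub>B (y + z)"
  proof (cases "x = 0")
    case True
    then show ?thesis by (simp add: bj_orthogonal_def)
  next
    case False
    define u where "u = inverse (norm x) *\<^sub>R x"
    have u: "norm u = 1" and x: "x = norm x *\<^sub>R u"
      using False by (simp_all add: u_def)
    have uorth: "u \<bottom>\<^sub>B y" "u \<bottom>\<^sub>B z"
      unfolding u_def using orth by (simp_all add: bj_orthogonal_scaleR_left)
    obtain f :: "'a \<Rightarrow>\<^sub>L real"
      where f: "norm f = 1" "blinfun_apply f u = 1" "blinfun_apply f y = 0"
      using bj_orthogonal_norming[OF uorth(1) u] by blast
    obtain g :: "'a \<Rightarrow>\<^sub>L real"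
      where g: "norm g = 1" "blinfun_apply g u = 1" "blinfun_apply g z = 0"
      using bj_orthogonal_norming[OF uorth(2) u] by blast
    have "f = g"
      using smooth u f g unfolding smooth_space_def by blast
    then have "u \<bottom>\<^sub>B (y + z)"
      using f g u by (intro bj_orthogonal_if_norming[of f]) (simp_all add: blinfun.add_right)
    then show ?thesis
      using bj_orthogonal_scaleR_left x by metis
  qed
qed

lemma right_additive_imp_smooth:
  assumes "bj_right_additive TYPE('a::real_normed_vector)"
  shows "smooth_space TYPE('a)"
  unfolding smooth_space_def
proof (intro allI impI)
  fix u :: 'a assume u: "norm u = 1"
  \<comment> \<open>Existence is the case of orthogonality to the zero vector.\<close>
  obtain f :: "'a \<Rightarrow>\<^sub>L real" where "norm f = 1" "blinfun_apply f u = 1"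
    using bj_orthogonal_norming[OF bj_orthogonal_zero_right u] by blast
  then show "\<exists>!f :: 'a \<Rightarrow>\<^sub>L real. norm f = 1 \<and> blinfun_apply f u = 1"
    using norming_functional_unique[OF assms u] by blast
qed

theorem corollary2p5p1:
  assumes "dim_greater_one TYPE('a::banach)"
  shows "bj_right_additive TYPE('a) \<longleftrightarrow> smooth_space TYPE('a)"
  using smooth_imp_right_additive right_additive_imp_smooth by blast

end
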